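(* Suppose that $f(z)=h(z)+\overline{g(z)}=\sum_{n=0}^{\infty}a_n z^n+\overline{\sum_{n=1}^{\infty}b_n z^n}$ is a sense-preserving harmonic mapping in $\mathbb{D}$ and $h\prec \varphi$, where $\varphi$ is analytic, univalent and convex in $\mathbb{D}$. Then $$\sum_{n=1}^{\infty}(|a_n|+|b_n|)r^n\leq \operatorname{dist}(\varphi(0),\partial\varphi(\mathbb{D}))$$ for $|z|=r\leq 1/5$. The number $1/5$ is sharp: it cannot be replaced by any larger number (that is, for every $\rho\in(1/5,1)$ there exist $f$ and $\varphi$ satisfying the hypotheses for which the inequality fails for some $r\le\rho$).
   Context: $\mathbb{D}=\{z\in\mathbb{C}:|z|<1\}$. A harmonic mapping $f$ in $\mathbb{D}$ is a complex-valued function whose real and imaginary parts are harmonic; it is written $f=h+\overline{g}$ with $h,g$ analytic in $\mathbb{D}$ and $g(0)=0$, $h(z)=\sum_{n\ge 0}a_nz^n$, $g(z)=\sum_{n\ge 1}b_nz^n$. A locally univalent harmonic mapping $f=h+\overline{g}$ is sense-preserving if $|h'(z)|^2-|g'(z)|^2>0$ in $\mathbb{D}$ (equivalently, the dilatation $\omega=g'/h'$ is analytic and maps $\mathbb{D}$ into itself). For analytic $h,\varphi$ in $\mathbb{D}$ with $h(0)=\varphi(0)$, $h\prec\varphi$ ($h$ is subordinate to $\varphi$) means $h(z)=\varphi(w(z))$ for some analytic $w$ on $\mathbb{D}$ with $|w(z)|\le|z|$. A univalent $\varphi$ is convex if $\varphi(\mathbb{D})$ is a convex domain. $\operatorname{dist}(\varphi(0),\partial\varphi(\mathbb{D}))$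 is the Euclidean distance from $\varphi(0)$ to the boundary of $\varphi(\mathbb{D})$. *)

theory Defs
  imports "HOL-Complex_Analysis.Complex_Analysis"
begin

abbreviation unit_disk :: "complex set" where
  "unit_disk \<equiv> ball 0 1"

text \<open>Real-valued harmonic functions: twice continuously differentiable with vanishing
  Laplacian. The witnesses are the partial derivatives with respect to the real and
  imaginary parts, e.g. \<open>uxy\<close> is the derivative of \<open>ux\<close> in the imaginary direction.\<close>

definition harmonic_on :: "(complex \<Rightarrow> real) \<Rightarrow> complex set \<Rightarrow> bool" where
  "harmonic_on u S \<longleftrightarrow> open S \<and>
     (\<exists>ux uy uxx uxy uyx uyy :: complex \<Rightarrow> real.
        continuous_on S uxx \<and> continuous_on S uxy \<and>
        continuous_on S uyx \<and> continuous_on S uyy \<and>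
        (\<forall>z\<in>S.
           (u has_derivative (\<lambda>v. ux z * Re v + uy z * Im v)) (at z) \<and>
           (ux has_derivative (\<lambda>v. uxx z * Re v + uxy z * Im v)) (at z) \<and>
           (uy has_derivative (\<lambda>v. uyx z * Re v + uyy z * Im v)) (at z) \<and>
           uxx z + uyy z = 0))"

definition harmonic_mapping_on :: "(complex \<Rightarrow> complex) \<Rightarrow> complex set \<Rightarrow> bool" where
  "harmonic_mapping_on f S \<longleftrightarrow>
     harmonic_on (\<lambda>z. Re (f z)) S \<and> harmonic_on (\<lambda>z. Im (f z)) S"

definition locally_univalent_on :: "(complex \<Rightarrow> complex) \<Rightarrow> complex set \<Rightarrow> bool" where
  "locally_univalent_on f S \<longleftrightarrow>
     (\<forall>z\<in>S. \<exists>U. open U \<and> z \<in> U \<and> U \<subseteq> S \<and> inj_on f U)"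

definition canonical_decomposition ::
  "(complex \<Rightarrow> complex) \<Rightarrow> (complex \<Rightarrow> complex) \<Rightarrow> (complex \<Rightarrow> complex) \<Rightarrow> bool" where
  "canonical_decomposition f h g \<longleftrightarrow>
     h holomorphic_on unit_disk \<and> g holomorphic_on unit_disk \<and> g 0 = 0 \<and>
     (\<forall>z\<in>unit_disk. f z = h z + cnj (g z))"

text \<open>The last conjunct says that the Jacobian of \<open>f\<close> is positive.\<close>

definition sense_preserving_harmonic ::
  "(complex \<Rightarrow> complex) \<Rightarrow> (complex \<Rightarrow> complex) \<Rightarrow> (complex \<Rightarrow> complex) \<Rightarrow> bool" where
  "sense_preserving_harmonic f h g \<longleftrightarrow>
     harmonic_mapping_on f unit_disk \<and> canonical_decomposition f h g \<and>
     locally_univalent_on f unit_disk \<and>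
     (\<forall>z\<in>unit_disk. (cmod (deriv h z))\<^sup>2 - (cmod (deriv g z))\<^sup>2 > 0)"

definition subordinate :: "(complex \<Rightarrow> complex) \<Rightarrow> (complex \<Rightarrow> complex) \<Rightarrow> bool" where
  "subordinate h \<phi> \<longleftrightarrow> h 0 = \<phi> 0 \<and>
     (\<exists>w. w holomorphic_on unit_disk \<and>
        (\<forall>z\<in>unit_disk. cmod (w z) \<le> cmod z \<and> h z = \<phi> (w z)))"

definition convex_univalent :: "(complex \<Rightarrow> complex) \<Rightarrow> bool" where
  "convex_univalent \<phi> \<longleftrightarrow>
     \<phi> holomorphic_on unit_disk \<and> inj_on \<phi> unit_disk \<and> convex (\<phi> ` unit_disk)"

text \<open>The series of \<open>g\<close> starts at index 1, so the value \<open>b 0\<close> is irrelevant here and below.\<close>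

definition bohr_hypotheses ::
  "(complex \<Rightarrow> complex) \<Rightarrow> (complex \<Rightarrow> complex) \<Rightarrow> (complex \<Rightarrow> complex) \<Rightarrow>
   (nat \<Rightarrow> complex) \<Rightarrow> (nat \<Rightarrow> complex) \<Rightarrow> (complex \<Rightarrow> complex) \<Rightarrow> bool" where
  "bohr_hypotheses f h g a b \<phi> \<longleftrightarrow>
     sense_preserving_harmonic f h g \<and>
     (\<forall>z\<in>unit_disk. (\<lambda>n. a n * z ^ n) sums h z) \<and>
     (\<forall>z\<in>unit_disk. (\<lambda>n. b (Suc n) * z ^ Suc n) sums g z) \<and>
     convex_univalent \<phi> \<and> subordinate h \<phi>"

definition bohr_term :: "(nat \<Rightarrow> complex) \<Rightarrow> (nat \<Rightarrow> complex) \<Rightarrow> real \<Rightarrow> nat \<Rightarrow> real" where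
  "bohr_term a b r n = (cmod (a n) + cmod (b n)) * r ^ n"

text \<open>The frontier is never empty for \<open>\<phi>\<close> as above, since an injective holomorphic function
  on the disk does not map onto the whole plane. So the convention
  \<open>infdist x {} = 0\<close> plays no role.\<close>

definition boundary_dist :: "(complex \<Rightarrow> complex) \<Rightarrow> real" where
  "boundary_dist \<phi> = infdist (\<phi> 0) (frontier (\<phi> ` unit_disk))"

end

theory Submission
  imports Defs
begin

text \<open>Let \<open>L\<close> be the distance from \<open>\<phi>(0)\<close> to the boundary of the convex domain \<open>\<phi>(\<D>)\<close>. A supporting
  line at a nearest boundary point shows that \<open>h - h(0)\<close> takes values in a half plane at distance
  at most \<open>L\<close> from the origin, and therefore \<open>|a\<^sub>n| \<le> 2L\<close> for \<open>n \<ge> 1\<close>. If \<open>\<omega> = g'/h'\<close> has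
  coefficients \<open>c\<^sub>n\<close>, then \<open>|c\<^sub>n| \<le> 1 - |c\<^sub>0|\<^sup>2\<close>, which gives Bohr's inequality
  \<open>\<Sum>|c\<^sub>n|r\<^sup>n \<le> 1\<close> for \<open>r \<le> 1/3\<close>. Comparing coefficients in \<open>g' = \<omega>h'\<close> yields
  \<open>\<Sum>|b\<^sub>n|r\<^sup>n \<le> \<Sum>|a\<^sub>n|r\<^sup>n\<close>, so the sum in question is at most \<open>4Lr/(1 - r)\<close>, which is at most \<open>L\<close>
  for \<open>r \<le> 1/5\<close>. Sharpness is seen from \<open>h(z) = z/(1 - z)\<close> and \<open>g = kh\<close> with \<open>k \<rightarrow> 1\<close>.\<close>

section \<open>Power series and averages over roots of unity\<close>

text \<open>Formal power series make coefficients unique and turn products of functions into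
  convolutions; this is the passage from convergent series to them.\<close>

lemma sums_imp_has_fps_expansion:
  fixes F :: "complex \<Rightarrow> complex"
  assumes "r > 0" and F: "\<And>z. z \<in> ball 0 r \<Longrightarrow> (\<lambda>n. c n * z ^ n) sums F z"
  shows "F has_fps_expansion Abs_fps c"
  unfolding has_fps_expansion_def
proof
  have "0 < ereal (norm (of_real (r/2) :: complex))"
    using \<open>r > 0\<close> by simp
  also have "\<dots> \<le> conv_radius c"
    using F[of "of_real (r/2)"] \<open>r > 0\<close>
    by (intro conv_radius_geI) (auto simp: sums_iff)
  finally show "fps_conv_radius (Abs_fps c) > 0"
    by (simp add: fps_conv_radius_def)
next
  have "eventually (\<lambda>z. z \<in> ball 0 r) (nhds (0::complex))"
    using \<open>r > 0\<close> by (intro eventually_nhds_in_open) auto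
  then show "\<forall>\<^sub>F z in nhds 0. eval_fps (Abs_fps c) z = F z"
    by eventually_elim (use F in \<open>auto simp: eval_fps_def sums_iff\<close>)
qed

text \<open>The summands are the powers of a single \<open>x\<close> with \<open>x ^ n = 1\<close>,
  so the geometric sum vanishes unless \<open>x = 1\<close>. The average thus filters out the
  coefficients whose index is not a multiple of \<open>n\<close>.\<close>

lemma roots_of_unity_average:
  assumes "n > 0"
  shows "(\<Sum>j<n. (exp (2 * of_real pi * \<i> * of_nat j / of_nat n)) ^ m) / of_nat n
           = (if n dvd m then 1 else (0::complex))"
proof -
  define x :: complex where "x = exp (2 * of_real pi * \<i> * of_nat m / of_nat n)"
  have pow: "(exp (2 * of_real pi * \<i> * of_nat j / of_nat n)) ^ m = x ^ j" for j
    unfolding x_def by (simp add: exp_of_nat_mult[symmetric] mult_ac)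
  have "x ^ n = 1"
    using pow[of n] \<open>n > 0\<close> by simp
  moreover have "x = 1 \<longleftrightarrow> n dvd m"
    unfolding x_def using \<open>n > 0\<close> by (intro complex_root_unity_eq_1) auto
  ultimately show ?thesis
    using \<open>n > 0\<close> by (auto simp: pow sum_gp_strict)
qed

text \<open>The map \<open>G\<close> with \<open>G(z\<^sup>n)\<close> the average of \<open>F\<close> over the \<open>n\<close>-th roots of unity times \<open>z\<close>. It reduces
  bounds on the \<open>n\<close>-th coefficient to the Schwarz lemma.\<close>

lemma holomorphic_every_nth_coefficient:
  fixes F :: "complex \<Rightarrow> complex"
  assumes F: "\<And>z. z \<in> ball 0 1 \<Longrightarrow> (\<lambda>k. c k * z ^ k) sums F z"
    and n: "n > 0" and C: "convex C" "F ` ball 0 1 \<subseteq> C"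
  obtains G where "G holomorphic_on ball 0 1" "G ` ball 0 1 \<subseteq> C" "G 0 = c 0" "deriv G 0 = c n"
proof -
  define \<zeta> :: "nat \<Rightarrow> complex" where "\<zeta> j = exp (2 * of_real pi * \<i> * of_nat j / of_nat n)" for j
  define G where "G z = (\<Sum>k. c (n * k) * z ^ k)" for z
  have \<zeta>: "norm (\<zeta> j) = 1" for j
    unfolding \<zeta>_def by (simp add: norm_exp_eq_Re)
  have key: "(\<lambda>k. c (n * k) * (u ^ n) ^ k) sums ((\<Sum>j<n. F (\<zeta> j * u)) / of_nat n)"
    if "u \<in> ball 0 1" for u
  proof -
    have "(\<lambda>m. (\<Sum>j<n. c m * (\<zeta> j * u) ^ m) / of_nat n) sums ((\<Sum>j<n. F (\<zeta> j * u)) / of_nat n)"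
      using that by (intro sums_divide sums_sum F) (auto simp: norm_mult \<zeta>)
    also have "(\<lambda>m. (\<Sum>j<n. c m * (\<zeta> j * u) ^ m) / of_nat n)
        = (\<lambda>m. c m * u ^ m * ((\<Sum>j<n. \<zeta> j ^ m) / of_nat n))"
      by (auto simp: power_mult_distrib sum_distrib_left mult_ac)
    also have "\<dots> = (\<lambda>m. if n dvd m then c m * u ^ m else 0)"
      unfolding \<zeta>_def roots_of_unity_average[OF n] by auto
    finally have "(\<lambda>k. (\<lambda>m. if n dvd m then c m * u ^ m else 0) (n * k))
        sums ((\<Sum>j<n. F (\<zeta> j * u)) / of_nat n)"
      by (subst sums_mono_reindex) (use n in \<open>auto simp: strict_mono_def dvd_def\<close>)
    then show ?thesis by (simp add: power_mult)
  qed
  have G: "(\<lambda>k. c (n * k) * z ^ k) sums G z \<and> G z \<in> C" if z: "z \<in> ball 0 1" for z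
  proof -
    \<comment> \<open>Every point of the disk is the \<open>n\<close>-th power of a point of the
      disk, so \<open>G z\<close> is an average of values of \<open>F\<close>, and convexity keeps
      it in \<open>C\<close>.\<close>
    obtain u where u: "u ^ n = z" using exists_complex_root[of n z] n by auto
    have "norm u ^ n < 1" using z u by (metis mem_ball_0 norm_power)
    then have "norm u < 1" by (metis n not_less one_le_power)
    then have ub: "u \<in> ball 0 1" by simp
    have "(\<Sum>j<n. (1 / real n) *\<^sub>R F (\<zeta> j * u)) \<in> C"
      by (rule convex_sum) (use n C \<zeta> \<open>norm u < 1\<close> in \<open>auto simp: norm_mult image_subset_iff\<close>)
    also have "(\<Sum>j<n. (1 / real n) *\<^sub>R F (\<zeta> j * u)) = (\<Sum>j<n. F (\<zeta> j * u)) / of_nat n"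
      by (simp add: scaleR_conv_of_real sum_divide_distrib)
    finally show ?thesis
      using key[OF ub] u unfolding G_def by (simp add: sums_iff)
  qed
  have "G has_fps_expansion Abs_fps (\<lambda>k. c (n * k))"
    by (rule sums_imp_has_fps_expansion[of 1]) (use G in auto)
  from fps_nth_fps_expansion[OF this, of 0] fps_nth_fps_expansion[OF this, of 1]
  have "G 0 = c 0" "deriv G 0 = c n" by auto
  moreover have "G holomorphic_on ball 0 1"
    by (rule power_series_holomorphic[where a = "\<lambda>k. c (n * k)"]) (use G in auto)
  ultimately show ?thesis using that G by blast
qed

section \<open>Coefficient bounds and Bohr's inequality in the disk\<close>

text \<open>After rotation by \<open>cnj d\<close>, the map \<open>p / (2L - p)\<close> takes the
  half plane \<open>Re p < L\<close> into the disk and fixes \<open>0\<close>, where its derivative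
  is \<open>1/(2L)\<close>. The Schwarz lemma for the composite \<open>q\<close> produces the factor
  \<open>2 * L\<close>.\<close>

lemma cmod_coefficient_le_halfplane:
  fixes F :: "complex \<Rightarrow> complex"
  assumes F: "\<And>z. z \<in> ball 0 1 \<Longrightarrow> (\<lambda>k. c k * z ^ k) sums F z"
    and n: "n > 0" and d: "cmod d = 1"
    and re: "\<And>z. z \<in> ball 0 1 \<Longrightarrow> d \<bullet> (F z - c 0) < L"
  shows "cmod (c n) \<le> 2 * L"
proof -
  have "F ` ball 0 1 \<subseteq> {w. d \<bullet> w < L + d \<bullet> c 0}"
    using re by (auto simp: inner_diff_right algebra_simps)
  then obtain G where G: "G holomorphic_on ball 0 1" "G ` ball 0 1 \<subseteq> {w. d \<bullet> w < L + d \<bullet> c 0}"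
      "G 0 = c 0" "deriv G 0 = c n"
    using holomorphic_every_nth_coefficient[OF F n convex_halfspace_lt] by metis
  define p where "p z = cnj d * (G z - c 0)" for z
  have Re_p: "Re (p z) < L" if "z \<in> ball 0 1" for z
    using G(2) that by (auto simp: p_def inner_diff_right inner_complex_def algebra_simps image_subset_iff)
  have L: "L > 0" using Re_p[of 0] G(3) by (simp add: p_def)
  have nz: "2 * of_real L - p z \<noteq> 0" if "z \<in> ball 0 1" for z
    using Re_p[OF that] L by (auto simp: complex_eq_iff)
  define q where "q z = p z / (2 * of_real L - p z)" for z
  have "p holomorphic_on ball 0 1"
    unfolding p_def by (intro holomorphic_intros G)
  then have q: "q holomorphic_on ball 0 1"
    unfolding q_def using nz by (intro holomorphic_intros) auto
  have q1: "norm (q z) < 1" if "norm z < 1" for z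
  proof -
    \<comment> \<open>The difference of the two squares is
      \<open>4 * L * (L - Re (p z))\<close>.\<close>
    have "(norm (p z))\<^sup>2 < (norm (2 * of_real L - p z))\<^sup>2"
      using mult_strict_left_mono[OF Re_p[of z] L] that
      by (simp add: cmod_power2) (simp add: power2_eq_square algebra_simps)
    then have "norm (p z) < norm (2 * of_real L - p z)"
      by (simp add: power2_less_imp_less)
    then show ?thesis by (simp add: q_def norm_divide divide_less_eq)
  qed
  have p0: "p 0 = 0" using G by (simp add: p_def)
  have dG: "(G has_field_derivative c n) (at 0)"
    using G by (metis centre_in_ball holomorphic_derivI open_ball zero_less_one)
  have "(p has_field_derivative cnj d * c n) (at 0)"
    unfolding p_def by (auto intro!: derivative_eq_intros dG)
  then have "(q has_field_derivative cnj d * c n / (2 * of_real L)) (at 0)"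
    unfolding q_def using L p0 by (auto intro!: derivative_eq_intros simp: field_simps)
  then have "deriv q 0 = cnj d * c n / (2 * of_real L)" by (rule DERIV_imp_deriv)
  moreover have "norm (deriv q 0) \<le> 1"
    by (rule Schwarz_Lemma(2)[OF q _ q1, of 0]) (auto simp: q_def p0)
  ultimately show ?thesis using d L by (simp add: norm_mult norm_divide divide_le_eq)
qed

text \<open>This is the Schwarz-Pick estimate at \<open>0\<close> for \<open>G\<close>: the Moebius
  map sending \<open>c 0\<close> to \<open>0\<close> has derivative \<open>1 / (1 - |c 0|^2)\<close>
  at \<open>c 0\<close>, and the composite has derivative at most \<open>1\<close> in
  modulus.\<close>

lemma cmod_coefficient_le_disk:
  fixes F :: "complex \<Rightarrow> complex"
  assumes F: "\<And>z. z \<in> ball 0 1 \<Longrightarrow> (\<lambda>k. c k * z ^ k) sums F z"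
    and n: "n > 0"
    and bound: "\<And>z. z \<in> ball 0 1 \<Longrightarrow> cmod (F z) < 1"
  shows "cmod (c n) \<le> 1 - (cmod (c 0))\<^sup>2"
proof -
  have "F ` ball 0 1 \<subseteq> ball 0 1" using bound by auto
  then obtain G where G: "G holomorphic_on ball 0 1" "G ` ball 0 1 \<subseteq> ball 0 1"
      "G 0 = c 0" "deriv G 0 = c n"
    using holomorphic_every_nth_coefficient[OF F n convex_ball] by metis
  have c0: "cmod (c 0) < 1" using G(2,3) by (metis centre_in_ball image_subset_iff mem_ball_0 zero_less_one)
  define q where "q = Moebius_function 0 (c 0) \<circ> G"
  have q: "q holomorphic_on ball 0 1"
    unfolding q_def
    using holomorphic_on_compose_gen[OF G(1) Moebius_function_holomorphic[OF c0] G(2)] .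
  have q1: "norm (q z) < 1" if "norm z < 1" for z
    unfolding q_def using G(2) that by (auto intro!: Moebius_function_norm_lt_1 c0 simp: image_subset_iff)
  have pos: "1 - (cmod (c 0))\<^sup>2 > 0" using c0 by (simp add: power_less_one_iff abs_square_less_1)
  have eq: "1 - cnj (c 0) * c 0 = of_real (1 - (cmod (c 0))\<^sup>2)"
    by (metis complex_norm_square mult.commute of_real_1 of_real_diff)
  have dG: "(G has_field_derivative c n) (at 0)"
    using G by (metis centre_in_ball holomorphic_derivI open_ball zero_less_one)
  have nz: "1 - cnj (c 0) * G 0 \<noteq> 0"
    using pos unfolding G(3) eq by (simp only: of_real_eq_0_iff)
  have "((\<lambda>z. G z - c 0) has_field_derivative c n) (at 0)"
    and "((\<lambda>z. 1 - cnj (c 0) * G z) has_field_derivative - (cnj (c 0) * c n)) (at 0)"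
    by (auto intro!: derivative_eq_intros dG)
  from DERIV_divide[OF this nz]
  have "((\<lambda>z. (G z - c 0) / (1 - cnj (c 0) * G z)) has_field_derivative c n / (1 - cnj (c 0) * c 0)) (at 0)"
    using nz G(3) by simp
  then have "deriv q 0 = c n / (1 - cnj (c 0) * c 0)"
    unfolding q_def comp_def Moebius_function_simple by (rule DERIV_imp_deriv)
  moreover have "norm (deriv q 0) \<le> 1"
    by (rule Schwarz_Lemma(2)[OF q _ q1, of 0]) (auto simp: q_def G Moebius_function_simple)
  ultimately have "cmod (c n) / (1 - (cmod (c 0))\<^sup>2) \<le> 1"
    unfolding eq by (simp only: norm_divide norm_of_real abs_of_pos[OF pos])
  then show ?thesis using pos by (simp only: pos_divide_le_eq mult_1)
qed

lemma sum_cmod_le_1_disk: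
  fixes F :: "complex \<Rightarrow> complex"
  assumes F: "\<And>z. z \<in> ball 0 1 \<Longrightarrow> (\<lambda>k. c k * z ^ k) sums F z"
    and bound: "\<And>z. z \<in> ball 0 1 \<Longrightarrow> cmod (F z) < 1"
    and r: "0 \<le> r" "r \<le> 1/3"
  shows "summable (\<lambda>k. cmod (c k) * r ^ k)" "(\<Sum>k. cmod (c k) * r ^ k) \<le> 1"
proof -
  define q where "q = 1 - (cmod (c 0))\<^sup>2"
  have c0: "cmod (c 0) < 1"
    using bound[of 0] sums_unique2[OF F[of 0] powser_sums_zero[of c]] by simp
  then have q: "q \<ge> 0" by (simp add: q_def power_le_one)
  have "(\<lambda>k. q * r * r ^ k) sums (q * r * (1 / (1 - r)))"
    using r by (intro sums_mult geometric_sums) auto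
  then have S: "(\<lambda>k. q * r ^ Suc k) sums (q * r * (1 / (1 - r)))"
    by (simp add: mult_ac)
  have le: "cmod (c (Suc k)) * r ^ Suc k \<le> q * r ^ Suc k" for k
    unfolding q_def using r by (intro mult_right_mono cmod_coefficient_le_disk[OF F _ bound]) auto
  have sm: "summable (\<lambda>k. cmod (c (Suc k)) * r ^ Suc k)"
    by (rule summable_comparison_test'[OF sums_summable[OF S], of 0]) (use le r in auto)
  then show sm': "summable (\<lambda>k. cmod (c k) * r ^ k)"
    by (subst (asm) summable_Suc_iff)
  have "(\<Sum>k. cmod (c (Suc k)) * r ^ Suc k) \<le> q * r * (1 / (1 - r))"
    using suminf_le[OF le sm sums_summable[OF S]] S by (simp add: sums_iff)
  \<comment> \<open>The radius \<open>1/3\<close> is where \<open>r / (1 - r)\<close> reaches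
    \<open>1/2\<close>.\<close>
  also have "\<dots> \<le> q * (1/2)"
    using mult_left_mono[OF _ q, of "r * (1 / (1 - r))" "1/2"] r by (simp add: field_simps)
  \<comment> \<open>With \<open>t = cmod (c 0)\<close>, the difference
    \<open>(1 - t) - (1 - t^2)/2\<close> is \<open>(1 - t)^2/2\<close>.\<close>
  also have "\<dots> \<le> 1 - cmod (c 0)"
    using zero_le_power2[of "1 - cmod (c 0)"] unfolding q_def by (simp add: power2_eq_square algebra_simps)
  finally show "(\<Sum>k. cmod (c k) * r ^ k) \<le> 1"
    using suminf_split_head[OF sm'] by simp
qed

section \<open>Comparison of the coefficients of \<open>g\<close> and \<open>h\<close>\<close>

text \<open>The moduli of the \<open>b\<close> are bounded by the convolution of those of the
  \<open>a\<close> with those of the coefficients \<open>c\<close> of \<open>g'/h'\<close>. A Cauchy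
  product then bounds the series of \<open>g\<close> by that of \<open>h\<close> times the sum of
  \<open>|c n| r^n\<close>, which is at most \<open>1\<close> by Bohr's inequality.\<close>

lemma analytic_part_dominates:
  fixes h g :: "complex \<Rightarrow> complex"
  assumes h: "\<And>z. z \<in> ball 0 1 \<Longrightarrow> (\<lambda>n. a n * z ^ n) sums h z"
    and g: "\<And>z. z \<in> ball 0 1 \<Longrightarrow> (\<lambda>n. b (Suc n) * z ^ Suc n) sums g z"
    and hol: "h holomorphic_on ball 0 1" "g holomorphic_on ball 0 1"
    and less: "\<And>z. z \<in> ball 0 1 \<Longrightarrow> cmod (deriv g z) < cmod (deriv h z)"
    and r: "0 \<le> r" "r \<le> 1/3"
    and sm: "summable (\<lambda>n. cmod (a (Suc n)) * r ^ Suc n)"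
  shows "summable (\<lambda>n. cmod (b (Suc n)) * r ^ Suc n)"
    "(\<Sum>n. cmod (b (Suc n)) * r ^ Suc n) \<le> (\<Sum>n. cmod (a (Suc n)) * r ^ Suc n)"
proof -
  define \<omega> where "\<omega> z = deriv g z / deriv h z" for z
  define c where "c n = (deriv ^^ n) \<omega> 0 / fact n" for n
  have h'0: "deriv h z \<noteq> 0" if "z \<in> ball 0 1" for z using less[OF that] by auto
  have "\<omega> holomorphic_on ball 0 1"
    unfolding \<omega>_def using h'0 by (intro holomorphic_intros hol) auto
  then have \<omega>: "(\<lambda>n. c n * z ^ n) sums \<omega> z" if "z \<in> ball 0 1" for z
    using holomorphic_power_series[of \<omega> 0 1 z] that by (simp add: c_def)
  have \<omega>1: "cmod (\<omega> z) < 1" if "z \<in> ball 0 1" for z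
    using less[OF that] by (simp add: \<omega>_def norm_divide divide_less_eq)
  define H where "H = Abs_fps a"
  \<comment> \<open>The constant coefficient is set to \<open>0\<close>, since the series of
    \<open>g\<close> starts at index \<open>1\<close>.\<close>
  define G where "G = Abs_fps (\<lambda>n. if n = 0 then 0 else b n)"
  define W where "W = Abs_fps c"
  have H: "h has_fps_expansion H"
    unfolding H_def by (rule sums_imp_has_fps_expansion[of 1]) (use h in auto)
  have W: "\<omega> has_fps_expansion W"
    unfolding W_def by (rule sums_imp_has_fps_expansion[of 1]) (use \<omega> in auto)
  have "(\<lambda>n. (if n = 0 then 0 else b n) * z ^ n) sums g z" if "z \<in> ball 0 1" for z
    using g[OF that] sums_Suc_iff[of "\<lambda>n. (if n = 0 then 0 else b n) * z ^ n" "g z"] by simp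
  then have G: "g has_fps_expansion G"
    unfolding G_def by (intro sums_imp_has_fps_expansion[of 1]) auto
  have "eventually (\<lambda>z. z \<in> ball 0 1) (nhds (0::complex))"
    by (intro eventually_nhds_in_open) auto
  then have "eventually (\<lambda>z. \<omega> z * deriv h z = deriv g z) (nhds 0)"
    by eventually_elim (use h'0 in \<open>simp add: \<omega>_def\<close>)
  moreover have "(\<lambda>z. \<omega> z * deriv h z) has_fps_expansion W * fps_deriv H"
    by (intro fps_expansion_intros W H)
  ultimately have "deriv g has_fps_expansion W * fps_deriv H"
    by (simp cong: has_fps_expansion_cong)
  moreover have "deriv g has_fps_expansion fps_deriv G"
    by (intro fps_expansion_intros G)
  ultimately have "fps_deriv G = W * fps_deriv H"
    using fps_expansion_eqI by metis
  then have coeff: "of_nat (Suc n) * b (Suc n) = (\<Sum>i\<le>n. c i * (of_nat (Suc (n - i)) * a (Suc (n - i))))" for n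
    by (simp add: fps_eq_iff fps_mult_nth G_def H_def W_def atLeast0AtMost)
  have b_le: "cmod (b (Suc n)) \<le> (\<Sum>i\<le>n. cmod (c i) * cmod (a (Suc (n - i))))" for n
  proof -
    \<comment> \<open>The factors \<open>n - i + 1\<close> from \<open>h'\<close> are dominated by the factor \<open>n + 1\<close> from \<open>g'\<close>.\<close>
    have "real (Suc n) * cmod (b (Suc n)) = cmod (of_nat (Suc n) * b (Suc n))"
      by (simp only: norm_mult norm_of_nat)
    also have "\<dots> \<le> (\<Sum>i\<le>n. cmod (c i) * (real (Suc (n - i)) * cmod (a (Suc (n - i)))))"
      unfolding coeff by (rule order_trans[OF norm_sum]) (simp only: norm_mult norm_of_nat order_refl)
    also have "\<dots> \<le> (\<Sum>i\<le>n. cmod (c i) * (real (Suc n) * cmod (a (Suc (n - i)))))"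
      by (intro sum_mono mult_left_mono mult_right_mono) auto
    also have "\<dots> = real (Suc n) * (\<Sum>i\<le>n. cmod (c i) * cmod (a (Suc (n - i))))"
      by (simp only: sum_distrib_left mult_ac)
    finally show ?thesis by (rule mult_left_le_imp_le) simp
  qed
  note bohr = sum_cmod_le_1_disk[OF \<omega> \<omega>1 r]
  let ?A = "\<Sum>n. cmod (a (Suc n)) * r ^ Suc n"
  \<comment> \<open>The series of \<open>a\<close> is shifted to start at index \<open>1\<close>, so
    the exponents \<open>i\<close> and \<open>Suc (n - i)\<close> add up to \<open>Suc n\<close>,
    the index of \<open>b\<close>.\<close>
  have "(\<lambda>n. \<Sum>i\<le>n. (cmod (c i) * r ^ i) * (cmod (a (Suc (n - i))) * r ^ Suc (n - i)))
          sums ((\<Sum>n. cmod (c n) * r ^ n) * ?A)"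
    by (rule Cauchy_product_sums) (use bohr(1) sm r in simp_all)
  moreover have "(\<Sum>i\<le>n. (cmod (c i) * r ^ i) * (cmod (a (Suc (n - i))) * r ^ Suc (n - i)))
      = (\<Sum>i\<le>n. cmod (c i) * cmod (a (Suc (n - i)))) * r ^ Suc n" for n
    unfolding sum_distrib_right
  proof (rule sum.cong)
    fix i assume "i \<in> {..n}"
    then have "r ^ Suc n = r ^ i * r ^ Suc (n - i)" by (simp add: power_add[symmetric] flip: power_Suc)
    then show "(cmod (c i) * r ^ i) * (cmod (a (Suc (n - i))) * r ^ Suc (n - i))
        = cmod (c i) * cmod (a (Suc (n - i))) * r ^ Suc n"
      by (simp only: mult_ac)
  qed simp
  ultimately have P: "(\<lambda>n. (\<Sum>i\<le>n. cmod (c i) * cmod (a (Suc (n - i)))) * r ^ Suc n)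
          sums ((\<Sum>n. cmod (c n) * r ^ n) * ?A)"
    by (simp only:)
  have le: "cmod (b (Suc n)) * r ^ Suc n \<le> (\<Sum>i\<le>n. cmod (c i) * cmod (a (Suc (n - i)))) * r ^ Suc n" for n
    using b_le r by (intro mult_right_mono) auto
  show smb: "summable (\<lambda>n. cmod (b (Suc n)) * r ^ Suc n)"
    by (rule summable_comparison_test'[OF sums_summable[OF P], of 0]) (use le r in auto)
  have "(\<Sum>n. cmod (b (Suc n)) * r ^ Suc n) \<le> (\<Sum>n. cmod (c n) * r ^ n) * ?A"
    using suminf_le[OF le smb sums_summable[OF P]] P by (simp only: sums_iff)
  also have "\<dots> \<le> 1 * ?A"
    using bohr(2) sm r by (intro mult_right_mono suminf_nonneg) auto
  finally show "(\<Sum>n. cmod (b (Suc n)) * r ^ Suc n) \<le> ?A" by simp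
qed

section \<open>Geometry of the convex image\<close>

text \<open>Otherwise the inverse would be a bounded entire function, hence constant by Liouville.
  This guarantees that the image has a boundary point.\<close>

lemma inj_holomorphic_disk_image_neq_UNIV:
  assumes "\<phi> holomorphic_on ball 0 1" "inj_on \<phi> (ball 0 1)"
  shows "\<phi> ` ball 0 1 \<noteq> UNIV"
proof
  assume eq: "\<phi> ` ball 0 1 = UNIV"
  obtain \<psi> where \<psi>: "\<psi> holomorphic_on UNIV" "\<And>z. z \<in> ball 0 1 \<Longrightarrow> \<psi> (\<phi> z) = z"
    using holomorphic_has_inverse[OF assms(1) open_ball assms(2)] eq by metis
  have "range \<psi> = ball 0 1"
    using \<psi>(2) unfolding eq[symmetric] by force
  then have "bounded (range \<psi>)" by simp
  then obtain c where "\<And>w. \<psi> w = c"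
    using Liouville_theorem[OF \<psi>(1)] by (auto simp: constant_on_def)
  with \<psi>(2)[of 0] \<psi>(2)[of "1/2"] show False by (auto simp: norm_divide)
qed

text \<open>The vector \<open>d\<close> is the unit normal of a supporting line at a boundary point
  \<open>c\<close> nearest to \<open>\<phi> 0\<close>; Cauchy-Schwarz bounds its product with
  \<open>c - \<phi> 0\<close> by the distance.\<close>

lemma boundary_dist_supporting_halfplane:
  assumes "convex_univalent \<phi>"
  obtains d where "cmod d = 1" "\<And>w. w \<in> \<phi> ` ball 0 1 \<Longrightarrow> d \<bullet> (w - \<phi> 0) < boundary_dist \<phi>"
proof -
  define S where "S = \<phi> ` ball 0 1"
  have hol: "\<phi> holomorphic_on ball 0 1" "inj_on \<phi> (ball 0 1)" and cvx: "convex S"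
    using assms by (auto simp: convex_univalent_def S_def)
  have S: "open S" "S \<noteq> UNIV" "\<phi> 0 \<in> S"
    using open_mapping_thm3[OF hol(1) open_ball hol(2)] inj_holomorphic_disk_image_neq_UNIV[OF hol]
    by (auto simp: S_def)
  have "frontier S \<noteq> {}" using S frontier_eq_empty by blast
  then obtain c where c: "c \<in> frontier S" "infdist (\<phi> 0) (frontier S) = dist (\<phi> 0) c"
    using infdist_attains_inf[OF frontier_closed] by metis
  have "c \<notin> S" using c(1) S(1) by (simp add: frontier_def interior_open)
  then obtain v \<beta> where v: "v \<noteq> 0" "\<And>x. x \<in> S \<Longrightarrow> v \<bullet> x \<le> \<beta>" "v \<bullet> c \<ge> \<beta>"
    using separating_hyperplane_sets[of S "{c}"] cvx S(3) by auto
  define d where "d = v /\<^sub>R norm v"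
  have nd: "norm d = 1" using v(1) by (simp add: d_def)
  \<comment> \<open>Openness of \<open>S\<close> turns the weak separation into a strict
    one.\<close>
  have "S \<subseteq> interior {x. v \<bullet> x \<le> \<beta>}"
    using v(2) S(1) by (intro interior_maximal) auto
  then have "v \<bullet> w < v \<bullet> c" if "w \<in> S" for w
    using v(1,3) that by (fastforce simp: interior_halfspace_le)
  then have "d \<bullet> (w - \<phi> 0) < d \<bullet> (c - \<phi> 0)" if "w \<in> S" for w
    using that v(1) by (simp add: d_def inner_diff_right)
  moreover have "d \<bullet> (c - \<phi> 0) \<le> dist (\<phi> 0) c"
    using norm_cauchy_schwarz[of d "c - \<phi> 0"] nd by (simp add: dist_norm norm_minus_commute)
  ultimately have "d \<bullet> (w - \<phi> 0) < boundary_dist \<phi>" if "w \<in> S" for w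
    using that c(2) unfolding boundary_dist_def S_def[symmetric] by fastforce
  then show ?thesis using that nd by (auto simp: S_def)
qed

section \<open>The inequality for radii up to \<open>1/5\<close>\<close>

lemma bohr_inequality:
  assumes "bohr_hypotheses f h g a b \<phi>" and r: "0 \<le> r" "r \<le> 1/5"
  shows "summable (\<lambda>n. bohr_term a b r (Suc n))"
    "(\<Sum>n. bohr_term a b r (Suc n)) \<le> boundary_dist \<phi>"
proof -
  have h: "(\<lambda>n. a n * z ^ n) sums h z" and g: "(\<lambda>n. b (Suc n) * z ^ Suc n) sums g z"
    if "z \<in> ball 0 1" for z
    using assms(1) that unfolding bohr_hypotheses_def by auto
  have \<phi>: "convex_univalent \<phi>" and sub: "h 0 = \<phi> 0" "\<And>z. z \<in> ball 0 1 \<Longrightarrow> h z \<in> \<phi> ` ball 0 1"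
    using assms(1) unfolding bohr_hypotheses_def subordinate_def
    by (auto intro!: imageI) (meson image_eqI le_less_trans mem_ball_0)
  have hol: "h holomorphic_on ball 0 1" "g holomorphic_on ball 0 1"
    and less: "cmod (deriv g z) < cmod (deriv h z)" if "z \<in> ball 0 1" for z
    using assms(1) that power2_less_imp_less[of "cmod (deriv g z)" "cmod (deriv h z)"]
    unfolding bohr_hypotheses_def sense_preserving_harmonic_def canonical_decomposition_def by auto
  define L where "L = boundary_dist \<phi>"
  obtain d where d: "cmod d = 1" "\<And>w. w \<in> \<phi> ` ball 0 1 \<Longrightarrow> d \<bullet> (w - \<phi> 0) < L"
    using boundary_dist_supporting_halfplane[OF \<phi>] unfolding L_def by metis
  have L: "L \<ge> 0" by (simp add: L_def boundary_dist_def infdist_nonneg)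
  have a0: "a 0 = \<phi> 0"
    using sums_unique2[OF h[of 0] powser_sums_zero[of a]] sub(1) by simp
  have a_le: "cmod (a (Suc n)) \<le> 2 * L" for n
    by (rule cmod_coefficient_le_halfplane[OF h _ d(1)]) (use d(2) sub(2) a0 in auto)
  have "(\<lambda>n. 2 * L * r * r ^ n) sums (2 * L * r * (1 / (1 - r)))"
    using r by (intro sums_mult geometric_sums) auto
  then have S: "(\<lambda>n. 2 * L * r ^ Suc n) sums (2 * L * r * (1 / (1 - r)))"
    by (simp add: mult_ac)
  have le: "cmod (a (Suc n)) * r ^ Suc n \<le> 2 * L * r ^ Suc n" for n
    using a_le r by (intro mult_right_mono) auto
  have sma: "summable (\<lambda>n. cmod (a (Suc n)) * r ^ Suc n)"
    by (rule summable_comparison_test'[OF sums_summable[OF S], of 0]) (use le r in auto)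
  have r3: "r \<le> 1/3" using r by simp
  note dom = analytic_part_dominates[OF h g hol[of 0] less r(1) r3 sma, simplified]
  have smb: "summable (\<lambda>n. cmod (b (Suc n)) * r ^ Suc n)"
    and dom: "(\<Sum>n. cmod (b (Suc n)) * r ^ Suc n) \<le> (\<Sum>n. cmod (a (Suc n)) * r ^ Suc n)"
    using dom by auto
  have split: "bohr_term a b r (Suc n) = cmod (a (Suc n)) * r ^ Suc n + cmod (b (Suc n)) * r ^ Suc n" for n
    by (simp only: bohr_term_def distrib_right)
  show "summable (\<lambda>n. bohr_term a b r (Suc n))"
    unfolding split by (intro summable_add sma smb)
  have "(\<Sum>n. bohr_term a b r (Suc n)) \<le> 2 * (\<Sum>n. cmod (a (Suc n)) * r ^ Suc n)"
    unfolding split suminf_add[OF sma smb, symmetric] using dom by simp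
  also have "\<dots> \<le> 2 * (2 * L * r * (1 / (1 - r)))"
    using suminf_le[OF le sma sums_summable[OF S]] S by (simp add: sums_iff)
  also have "\<dots> = L * (4 * r / (1 - r))" by simp
  \<comment> \<open>For \<open>r < 1\<close>, the factor \<open>4 * r / (1 - r)\<close> is at most
    \<open>1\<close> exactly when \<open>r \<le> 1/5\<close>.\<close>
  also have "\<dots> \<le> L * 1"
    using r L by (intro mult_left_mono) (auto simp: field_simps)
  finally show "(\<Sum>n. bohr_term a b r (Suc n)) \<le> boundary_dist \<phi>" by (simp add: L_def)
qed

section \<open>Harmonicity of real parts of holomorphic functions\<close>

lemma has_derivative_Re_field:
  assumes "(F has_field_derivative D) (at z)"
  shows "((\<lambda>z. Re (F z)) has_derivative (\<lambda>v. Re D * Re v + - Im D * Im v)) (at z)"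
  using assms unfolding has_field_derivative_def
  by (auto intro!: derivative_eq_intros simp: fun_eq_iff)

text \<open>By Cauchy-Riemann, \<open>- Im F'\<close> is the partial derivative of
  \<open>Re F\<close> in the imaginary direction; this form gives its second partial
  derivatives.\<close>

lemma has_derivative_minus_Im_field:
  assumes "(F has_field_derivative D) (at z)"
  shows "((\<lambda>z. - Im (F z)) has_derivative (\<lambda>v. - Im D * Re v + - Re D * Im v)) (at z)"
  using assms unfolding has_field_derivative_def
  by (auto intro!: derivative_eq_intros simp: fun_eq_iff algebra_simps)

lemma harmonic_on_Re_holomorphic:
  assumes F: "F holomorphic_on S" and S: "open S"
  shows "harmonic_on (\<lambda>z. Re (F z)) S"
proof -
  let ?F' = "deriv F" and ?F'' = "deriv (deriv F)"
  have F': "?F' holomorphic_on S" by (rule holomorphic_deriv[OF F S])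
  then have "?F'' holomorphic_on S" by (rule holomorphic_deriv[OF _ S])
  then have cont: "continuous_on S ?F''" by (rule holomorphic_on_imp_continuous_on)
  note D = holomorphic_derivI[OF F S] holomorphic_derivI[OF F' S]
  show ?thesis
    unfolding harmonic_on_def
  proof (intro conjI S)
    show "\<exists>ux uy uxx uxy uyx uyy :: complex \<Rightarrow> real.
        continuous_on S uxx \<and> continuous_on S uxy \<and> continuous_on S uyx \<and> continuous_on S uyy \<and>
        (\<forall>z\<in>S. ((\<lambda>z. Re (F z)) has_derivative (\<lambda>v. ux z * Re v + uy z * Im v)) (at z) \<and>
           (ux has_derivative (\<lambda>v. uxx z * Re v + uxy z * Im v)) (at z) \<and>
           (uy has_derivative (\<lambda>v. uyx z * Re v + uyy z * Im v)) (at z) \<and> uxx z + uyy z = 0)"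
      apply (rule exI[of _ "\<lambda>z. Re (?F' z)"], rule exI[of _ "\<lambda>z. - Im (?F' z)"])
      apply (rule exI[of _ "\<lambda>z. Re (?F'' z)"], rule exI[of _ "\<lambda>z. - Im (?F'' z)"])
      apply (rule exI[of _ "\<lambda>z. - Im (?F'' z)"], rule exI[of _ "\<lambda>z. - Re (?F'' z)"])
      apply (intro conjI ballI continuous_intros cont has_derivative_Re_field has_derivative_minus_Im_field)
      using D by auto
  qed
qed

section \<open>The half plane map and sharpness\<close>

lemma half_plane_map:
  shows "(\<lambda>z::complex. z / (1 - z)) holomorphic_on ball 0 1" "inj_on (\<lambda>z::complex. z / (1 - z)) (ball 0 1)"
    "(\<lambda>z::complex. z / (1 - z)) ` ball 0 1 = {w. Re w > -1/2}"
proof -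
  have nz: "1 - z \<noteq> 0" if "z \<in> ball 0 1" for z :: complex
    using that by auto
  show "(\<lambda>z::complex. z / (1 - z)) holomorphic_on ball 0 1"
    using nz by (intro holomorphic_intros) auto
  show "inj_on (\<lambda>z::complex. z / (1 - z)) (ball 0 1)"
    using nz by (intro inj_onI) (simp add: frac_eq_eq algebra_simps)
  \<comment> \<open>The inequality says that \<open>w\<close> is closer to \<open>0\<close> than to
    \<open>-1\<close>, which is also the condition for the preimage \<open>w / (1 + w)\<close> to
    lie in the disk.\<close>
  have norm_iff: "cmod w < cmod (1 + w) \<longleftrightarrow> Re w > -1/2" for w
  proof -
    have "cmod w < cmod (1 + w) \<longleftrightarrow> (cmod w)\<^sup>2 < (cmod (1 + w))\<^sup>2"
      by (metis norm_ge_zero power_strict_mono power2_less_imp_less zero_less_numeral)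
    also have "\<dots> \<longleftrightarrow> Re w > -1/2"
      by (simp add: cmod_power2) (simp add: power2_eq_square algebra_simps, linarith)
    finally show ?thesis .
  qed
  show "(\<lambda>z::complex. z / (1 - z)) ` ball 0 1 = {w. Re w > -1/2}"
  proof (intro subset_antisym subsetI)
    fix w :: complex assume "w \<in> (\<lambda>z. z / (1 - z)) ` ball 0 1"
    then obtain z where z: "cmod z < 1" "w = z / (1 - z)" by auto
    then have "1 - z \<noteq> 0" by auto
    then have "1 + w = 1 / (1 - z)" using z(2) by (simp add: field_simps)
    then have "cmod w < cmod (1 + w)"
      using z \<open>1 - z \<noteq> 0\<close> by (simp add: norm_divide divide_strict_right_mono)
    then show "w \<in> {w. Re w > -1/2}" using norm_iff by blast
  next
    fix w :: complex assume "w \<in> {w. Re w > -1/2}"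
    then have w: "cmod w < cmod (1 + w)" using norm_iff by blast
    then have nz: "1 + w \<noteq> 0" by auto
    show "w \<in> (\<lambda>z. z / (1 - z)) ` ball 0 1"
    proof (rule image_eqI)
      show "w = w / (1 + w) / (1 - w / (1 + w))" using nz by (simp add: field_simps)
      show "w / (1 + w) \<in> ball 0 1" using w nz by (simp add: norm_divide divide_less_eq)
    qed
  qed
qed

lemma convex_univalent_half_plane_map: "convex_univalent (\<lambda>z. z / (1 - z))"
  unfolding convex_univalent_def half_plane_map(3)
  by (intro conjI half_plane_map convex_halfspace_Re_gt)

text \<open>The boundary point \<open>-1/2\<close> has distance \<open>1/2\<close> from
  \<open>0\<close>, the image of the centre.\<close>

lemma boundary_dist_half_plane_map: "boundary_dist (\<lambda>z. z / (1 - z)) \<le> 1/2"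
proof -
  have "frontier {w. Re w > -1/2} = {w. (1::complex) \<bullet> w = -1/2}"
    using frontier_halfspace_gt[of "1::complex" "-1/2"] by (simp add: inner_complex_def)
  then have "(-1/2 :: complex) \<in> frontier ((\<lambda>z. z / (1 - z)) ` ball 0 1)"
    unfolding half_plane_map(3) by (simp add: inner_complex_def)
  then show ?thesis
    unfolding boundary_dist_def by (intro infdist_le2) (auto simp: dist_norm norm_divide)
qed

lemma half_plane_map_sums:
  assumes "z \<in> ball 0 (1::real)"
  shows "(\<lambda>n. z ^ Suc n) sums (z / (1 - z :: complex))"
  using sums_mult[OF geometric_sums[of z], of z] assms by simp

lemma deriv_half_plane_map_nonzero:
  assumes "z \<in> ball 0 1"
  shows "deriv (\<lambda>z::complex. z / (1 - z)) z \<noteq> 0"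
proof -
  have "1 - z \<noteq> 0" using assms by auto
  then have "((\<lambda>z. z / (1 - z)) has_field_derivative 1 / (1 - z)\<^sup>2) (at z)"
    by (auto intro!: derivative_eq_intros simp: field_simps power2_eq_square)
  then show ?thesis using \<open>1 - z \<noteq> 0\<close> by (simp add: DERIV_imp_deriv)
qed

text \<open>The mapping has real part \<open>(1 + k) * Re h\<close> and imaginary part
  \<open>(1 - k) * Im h\<close>. For \<open>k < 1\<close> this is an invertible real-linear stretch
  of \<open>h\<close>, so injectivity carries over; the dilatation is the constant
  \<open>k\<close>.\<close>

lemma bohr_hypotheses_half_plane_map:
  fixes k :: real
  assumes k: "0 \<le> k" "k < 1"
  defines "h \<equiv> \<lambda>z::complex. z / (1 - z)"
  defines "g \<equiv> \<lambda>z. of_real k * h z"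
  shows "bohr_hypotheses (\<lambda>z. h z + cnj (g z)) h g (\<lambda>n. if n = 0 then 0 else 1) (\<lambda>n. of_real k) h"
proof -
  let ?f = "\<lambda>z. h z + cnj (g z)"
  have h: "h holomorphic_on ball 0 1" "inj_on h (ball 0 1)"
    unfolding h_def by (rule half_plane_map)+
  have g: "g holomorphic_on ball 0 1" unfolding g_def by (intro holomorphic_intros h)
  \<comment> \<open>The imaginary part is written as the real part of
    \<open>- \<i> * (1 - k) * h\<close>, so both parts are real parts of holomorphic
    functions.\<close>
  have "harmonic_on (\<lambda>z. Re (of_real (1 + k) * h z)) unit_disk"
    "harmonic_on (\<lambda>z. Re (- \<i> * of_real (1 - k) * h z)) unit_disk"
    by (intro harmonic_on_Re_holomorphic holomorphic_intros h open_ball)+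
  then have harm: "harmonic_mapping_on ?f unit_disk"
    unfolding harmonic_mapping_on_def g_def by (simp add: algebra_simps)
  have "inj_on ?f unit_disk"
  proof (rule inj_onI)
    fix x y assume xy: "x \<in> unit_disk" "y \<in> unit_disk" "?f x = ?f y"
    have "(1 + k) * Re (h x) = (1 + k) * Re (h y)" "(1 - k) * Im (h x) = (1 - k) * Im (h y)"
      using xy(3) unfolding g_def complex_eq_iff by (auto simp: algebra_simps)
    then have "h x = h y" using k by (auto simp: complex_eq_iff)
    then show "x = y" using h(2) xy by (auto dest: inj_onD)
  qed
  then have "locally_univalent_on ?f unit_disk"
    unfolding locally_univalent_on_def by blast
  moreover have "(cmod (deriv h z))\<^sup>2 - (cmod (deriv g z))\<^sup>2 > 0" if "z \<in> unit_disk" for z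
  proof -
    have nz: "cmod (deriv h z) > 0" unfolding h_def using deriv_half_plane_map_nonzero[OF that] by simp
    have "deriv g z = of_real k * deriv h z"
      unfolding g_def using h(1) that by (intro deriv_cmult holomorphic_on_imp_differentiable_at[OF _ open_ball])
    then have "cmod (deriv g z) < cmod (deriv h z)" using k nz by (simp add: norm_mult)
    then show ?thesis by (simp add: power_strict_mono)
  qed
  ultimately have "sense_preserving_harmonic ?f h g"
    unfolding sense_preserving_harmonic_def canonical_decomposition_def
    using harm h g by (auto simp: g_def h_def)
  moreover have "(\<lambda>n. (if n = 0 then 0 else 1) * z ^ n) sums h z" if "z \<in> unit_disk" for z
    using half_plane_map_sums[OF that] sums_Suc_iff[of "\<lambda>n. (if n = 0 then 0 else 1) * z ^ n" "h z"]
    by (simp add: h_def)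
  moreover have "(\<lambda>n. of_real k * z ^ Suc n) sums g z" if "z \<in> unit_disk" for z
    unfolding g_def h_def by (intro sums_mult half_plane_map_sums that)
  moreover have "subordinate h h"
    unfolding subordinate_def by (auto intro!: exI[of _ "\<lambda>z. z"])
  moreover have "convex_univalent h"
    unfolding h_def by (rule convex_univalent_half_plane_map)
  ultimately show ?thesis unfolding bohr_hypotheses_def by blast
qed

lemma bohr_radius_sharp:
  fixes \<rho> :: real
  assumes \<rho>: "1/5 < \<rho>" "\<rho> < 1"
  shows "\<exists>f h g a b \<phi> r. bohr_hypotheses f h g a b \<phi> \<and> 0 \<le> r \<and> r \<le> \<rho> \<and>
           summable (\<lambda>n. bohr_term a b r (Suc n)) \<and>
           boundary_dist \<phi> < (\<Sum>n. bohr_term a b r (Suc n))"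
proof -
  \<comment> \<open>This is the sum of \<open>\<rho> ^ n\<close> over \<open>n \<ge> 1\<close>, so
    the Bohr sum at \<open>r = \<rho>\<close> is \<open>(1 + k) * q\<close>.\<close>
  define q where "q = \<rho> / (1 - \<rho>)"
  have q: "q > 1/4" using \<rho> by (simp add: q_def field_simps)
  \<comment> \<open>The lower bound on \<open>k\<close> means \<open>(1 + k) * q > 1/2\<close>, and
    \<open>q > 1/4\<close> leaves room for it below \<open>1\<close>; the maximum keeps
    \<open>k\<close> nonnegative.\<close>
  obtain k where k: "max 0 (1 / (2 * q) - 1) < k" "k < 1"
    using dense[of "max 0 (1 / (2 * q) - 1)" 1] q by (auto simp: field_simps)
  let ?a = "\<lambda>n::nat. if n = 0 then 0 else (1::complex)" and ?b = "\<lambda>n::nat. complex_of_real k"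
  have "(\<lambda>n. (1 + k) * \<rho> * \<rho> ^ n) sums ((1 + k) * \<rho> * (1 / (1 - \<rho>)))"
    using \<rho> by (intro sums_mult geometric_sums) auto
  then have S: "(\<lambda>n. bohr_term ?a ?b \<rho> (Suc n)) sums ((1 + k) * q)"
    using k by (simp add: bohr_term_def q_def mult_ac)
  have "1/2 < (1 + k) * q" using k q by (simp add: field_simps)
  then have "boundary_dist (\<lambda>z. z / (1 - z)) < (\<Sum>n. bohr_term ?a ?b \<rho> (Suc n))"
    using boundary_dist_half_plane_map sums_unique[OF S] by simp
  moreover have "0 \<le> k" using k by simp
  note bohr_hypotheses_half_plane_map[OF this k(2)]
  moreover have "0 \<le> \<rho>" "\<rho> \<le> \<rho>" using \<rho> by auto
  ultimately show ?thesis
    using sums_summable[OF S] by blast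
qed

theorem corollary1:
  shows "(\<forall>f h g a b \<phi> r.
            bohr_hypotheses f h g a b \<phi> \<and> 0 \<le> r \<and> r \<le> 1/5 \<longrightarrow>
            summable (\<lambda>n. bohr_term a b r (Suc n)) \<and>
            (\<Sum>n. bohr_term a b r (Suc n)) \<le> boundary_dist \<phi>) \<and>
         (\<forall>\<rho>::real. 1/5 < \<rho> \<and> \<rho> < 1 \<longrightarrow>
            (\<exists>f h g a b \<phi> r.
               bohr_hypotheses f h g a b \<phi> \<and> 0 \<le> r \<and> r \<le> \<rho> \<and>
               summable (\<lambda>n. bohr_term a b r (Suc n)) \<and>
               boundary_dist \<phi> < (\<Sum>n. bohr_term a b r (Suc n))))"
  by (intro conjI allI impI; (elim conjE)?; rule bohr_inequality bohr_radius_sharp; assumption)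

end
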